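(* Let $p$ be a prime number. For any (finite) simple graph $\Gamma$ on $m$ vertices, $$s_{\mathbb{F}_p}(\Gamma)=m-\left\lceil \log_p\big((p-1)\gamma(\Gamma)+1\big)\right\rceil .$$
   Context: A simplicial map is nondegenerate if it is injective on every simplex. $K(\mathbb{F}_p^r)$ is the simplicial complex whose vertices are the one-dimensional subspaces (lines) of $\mathbb{F}_p^r$ and whose $k$-simplices are the sets of $k+1$ lines spanning a $(k+1)$-dimensional subspace. For a simplicial complex $K$ on $m$ vertices, the mod $p$ Buchstaber invariant is $s_{\mathbb{F}_p}(K)=m-r$, where $r$ is the least integer such that there is a nondegenerate simplicial map $K\to K(\mathbb{F}_p^r)$. The chromatic number $\gamma(K)$ is the minimal number $\gamma$ such that there is a nondegenerate simplicial map from $K$ to the simplex $\Delta^{\gamma-1}$. A graph is viewed as a simplicial complex of dimension at most $1$; then $\gamma(\Gamma)$ is the usual chromatic number. *)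

theory Defs
  imports
    Complex_Main
    "HOL-Number_Theory.Residues"
    "Jordan_Normal_Form.Missing_VectorSpace"
begin

section \<open>Simplicial complexes and nondegenerate maps\<close>

text \<open>
  A simplicial complex is the family of its nonempty simplices, so that \<open>\<Union>K\<close> is its vertex
  set and every vertex is a simplex.
\<close>

definition simplicial_complex :: "'a set set \<Rightarrow> bool" where
  "simplicial_complex K \<longleftrightarrow>
     (\<forall>\<sigma>\<in>K. finite \<sigma> \<and> \<sigma> \<noteq> {} \<and> (\<forall>\<tau>. \<tau> \<subseteq> \<sigma> \<and> \<tau> \<noteq> {} \<longrightarrow> \<tau> \<in> K))"

definition simplicial_map :: "'a set set \<Rightarrow> 'b set set \<Rightarrow> ('a \<Rightarrow> 'b) \<Rightarrow> bool" where
  "simplicial_map K L f \<longleftrightarrow> (\<forall>\<sigma>\<in>K. f ` \<sigma> \<in> L)"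

definition nondegenerate_map :: "'a set set \<Rightarrow> 'b set set \<Rightarrow> ('a \<Rightarrow> 'b) \<Rightarrow> bool" where
  "nondegenerate_map K L f \<longleftrightarrow> simplicial_map K L f \<and> (\<forall>\<sigma>\<in>K. inj_on f \<sigma>)"

text \<open>\<open>full_simplex n\<close> is \<open>\<Delta>\<^sup>n\<^sup>-\<^sup>1\<close>, the simplex with \<open>n\<close> vertices (empty for \<open>n = 0\<close>).\<close>

definition full_simplex :: "nat \<Rightarrow> nat set set" where
  "full_simplex n = {\<sigma>. \<sigma> \<noteq> {} \<and> \<sigma> \<subseteq> {..<n}}"

definition chromatic_number :: "'a set set \<Rightarrow> nat" where
  "chromatic_number K = (LEAST n. \<exists>f. nondegenerate_map K (full_simplex n) f)"


section \<open>The mod \<open>p\<close> Buchstaber invariant\<close>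

text \<open>The vector space of \<open>r\<close>-tuples over \<open>\<int>/p\<int>\<close>; its vectors are extensional on \<open>{..<r}\<close>.\<close>

definition Fp_space :: "nat \<Rightarrow> nat \<Rightarrow> (int, nat \<Rightarrow> int) module" where
  "Fp_space p r = LinearCombinations.ring.func_space (residue_ring (int p)) {..<r}"

lemma vectorspace_Fp_space:
  assumes "prime p"
  shows "vectorspace (residue_ring (int p)) (Fp_space p r)"
proof -
  interpret residues_prime p "residue_ring (int p)"
    by unfold_locales (use assms in auto)
  show ?thesis
    unfolding Fp_space_def vectorspace_def
    by (intro conjI cring.func_space_is_module cring is_field)
qed

text \<open>\<open>Fp_dim p r W\<close> is the dimension of a linear subspace \<open>W\<close> of \<open>Fp_space p r\<close>.\<close>

definition Fp_dim :: "nat \<Rightarrow> nat \<Rightarrow> (nat \<Rightarrow> int) set \<Rightarrow> nat" where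
  "Fp_dim p r W = vectorspace.dim (residue_ring (int p)) ((Fp_space p r)\<lparr>carrier := W\<rparr>)"

definition Fp_lines :: "nat \<Rightarrow> nat \<Rightarrow> (nat \<Rightarrow> int) set set" where
  "Fp_lines p r =
     {L. VectorSpace.subspace (residue_ring (int p)) L (Fp_space p r) \<and> Fp_dim p r L = 1}"

definition universal_complex :: "nat \<Rightarrow> nat \<Rightarrow> (nat \<Rightarrow> int) set set set" where
  "universal_complex p r =
     {\<sigma>. finite \<sigma> \<and> \<sigma> \<noteq> {} \<and> \<sigma> \<subseteq> Fp_lines p r \<and>
         Fp_dim p r
           (LinearCombinations.module.span (residue_ring (int p)) (Fp_space p r) (\<Union>\<sigma>)) = card \<sigma>}"

definition buchstaber_mod :: "nat \<Rightarrow> 'a set set \<Rightarrow> int" where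
  "buchstaber_mod p K =
     int (card (\<Union>K)) - int (LEAST r. \<exists>f. nondegenerate_map K (universal_complex p r) f)"


section \<open>Graphs\<close>

definition simple_graph :: "'a set \<Rightarrow> 'a set set \<Rightarrow> bool" where
  "simple_graph V E \<longleftrightarrow> finite V \<and> (\<forall>e\<in>E. e \<subseteq> V \<and> card e = 2)"

definition graph_complex :: "'a set \<Rightarrow> 'a set set \<Rightarrow> 'a set set" where
  "graph_complex V E = (\<lambda>v. {v}) ` V \<union> E"

lemma simplicial_complex_graph_complex:
  assumes "simple_graph V E"
  shows "simplicial_complex (graph_complex V E)" and "\<Union>(graph_complex V E) = V"
proof -
  have sub: "\<tau> \<in> graph_complex V E" if "e \<in> E" "\<tau> \<subseteq> e" "\<tau> \<noteq> {}" for e \<tau>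
  proof -
    obtain a b where ab: "e = {a, b}"
      using assms \<open>e \<in> E\<close> unfolding simple_graph_def card_2_iff by meson
    moreover have "e \<subseteq> V"
      using assms \<open>e \<in> E\<close> unfolding simple_graph_def by simp
    moreover have "\<tau> = {a} \<or> \<tau> = {b} \<or> \<tau> = e"
      using that unfolding ab by blast
    ultimately show ?thesis
      using \<open>e \<in> E\<close> unfolding graph_complex_def by auto
  qed
  have fin: "finite e \<and> e \<noteq> {}" if "e \<in> E" for e
  proof -
    have "card e = 2"
      using assms that unfolding simple_graph_def by simp
    then show ?thesis
      by (intro conjI card_ge_0_finite) auto
  qed
  have "finite \<sigma> \<and> \<sigma> \<noteq> {} \<and> (\<forall>\<tau>. \<tau> \<subseteq> \<sigma> \<and> \<tau> \<noteq> {} \<longrightarrow> \<tau> \<in> graph_complex V E)"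
    if \<sigma>: "\<sigma> \<in> graph_complex V E" for \<sigma>
  proof (cases "\<sigma> \<in> E")
    case True
    then show ?thesis
      using fin sub by simp
  next
    case False
    then obtain v where v: "\<sigma> = {v}"
      using \<sigma> unfolding graph_complex_def by auto
    have "\<tau> = \<sigma>" if "\<tau> \<subseteq> \<sigma>" "\<tau> \<noteq> {}" for \<tau>
      using that unfolding v by (simp add: subset_singleton_iff)
    then show ?thesis
      using \<sigma> unfolding v by blast
  qed
  then show "simplicial_complex (graph_complex V E)"
    unfolding simplicial_complex_def by (rule ballI)
  have "\<Union>E \<subseteq> V"
    using assms unfolding simple_graph_def by (simp add: Sup_le_iff)
  then show "\<Union>(graph_complex V E) = V"
    unfolding graph_complex_def by auto
qed

end

theory Submission
  imports Defs
begin

text \<open>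
  A graph has simplices with at most two vertices, so a nondegenerate map out of it only sees the
  \<open>1\<close>-skeleton of its target. Any two distinct lines span a plane (\<open>dim_span_Union_lines\<close>), hence
  the \<open>1\<close>-skeleton of \<open>K(F\<^sub>p\<^sup>r)\<close> is the complete graph on the lines of \<open>F\<^sub>p\<^sup>r\<close>, just as that of the
  simplex with \<open>n\<close> vertices is the complete graph on \<open>n\<close> vertices. In both cases a nondegenerate map
  is a proper colouring of the graph by the vertices of the target
  (\<open>nondegenerate_map_graph_complex_iff\<close>), and a colouring by a finite set of colours exists exactly
  when there are at least \<open>\<gamma>\<close> colours (\<open>colourable_iff_chromatic_number_le\<close>).

  The lines partition the \<open>p\<^sup>r - 1\<close> nonzero vectors into blocks of \<open>p - 1\<close> (\<open>card_lines\<close>), so a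
  nondegenerate map to \<open>K(F\<^sub>p\<^sup>r)\<close> exists iff \<open>(p - 1) * \<gamma> \<le> p\<^sup>r - 1\<close>. The least such \<open>r\<close> is the
  rounded-up logarithm to the base \<open>p\<close> of \<open>(p - 1) * \<gamma> + 1\<close>.
\<close>

section \<open>Lines in a vector space\<close>

context vectorspace
begin

lemma span_singleton:
  assumes "v \<in> carrier V"
  shows "span {v} = {c \<odot>\<^bsub>V\<^esub> v |c. c \<in> carrier K}"
proof -
  have *: "lincomb a {v} = a v \<odot>\<^bsub>V\<^esub> v" if "a \<in> {v} \<rightarrow> carrier K" for a
    using that assms by (simp add: lincomb_def)
  have "span {v} = {lincomb a {v} |a. a \<in> {v} \<rightarrow> carrier K}"
    using assms by (intro finite_span) auto
  also have "\<dots> = {c \<odot>\<^bsub>V\<^esub> v |c. c \<in> carrier K}"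
  proof (intro equalityI subsetI)
    fix x assume "x \<in> {lincomb a {v} |a. a \<in> {v} \<rightarrow> carrier K}"
    then show "x \<in> {c \<odot>\<^bsub>V\<^esub> v |c. c \<in> carrier K}"
      using * by auto
  next
    fix x assume "x \<in> {c \<odot>\<^bsub>V\<^esub> v |c. c \<in> carrier K}"
    then obtain c where "c \<in> carrier K" "x = c \<odot>\<^bsub>V\<^esub> v" by auto
    then show "x \<in> {lincomb a {v} |a. a \<in> {v} \<rightarrow> carrier K}"
      using *[of "\<lambda>_. c"] by force
  qed
  finally show ?thesis .
qed

lemma lin_indpt_singleton:
  assumes "v \<in> carrier V" "v \<noteq> \<zero>\<^bsub>V\<^esub>"
  shows "lin_indpt {v}"
  using assms lindep_span[of "{v}"] by (simp add: span_empty)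

text \<open>
  Linear independence of \<open>A\<close> does not depend on the ambient space, so \<open>A\<close> is a basis of its span.
\<close>

lemma dim_span_lin_indpt:
  assumes "finite A" "A \<subseteq> carrier V" "lin_indpt A"
  shows "vectorspace.dim K (vs (span A)) = card A"
proof -
  interpret W: vectorspace K "vs (span A)"
    using assms by (intro subspace_is_vs span_is_subspace)
  have A: "A \<subseteq> span A"
    using assms by (intro in_own_span)
  have "W.basis A"
    unfolding W.basis_def using span_li_not_depend[OF A span_is_submodule] assms A by simp
  then show ?thesis
    using assms by (intro W.dim_basis)
qed

lemma span_singleton_eqI:
  assumes v: "v \<in> carrier V" and w: "w \<in> span {v}" "w \<noteq> \<zero>\<^bsub>V\<^esub>"
  shows "span {w} = span {v}"
proof -
  obtain c where c: "c \<in> carrier K" "w = c \<odot>\<^bsub>V\<^esub> v"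
    using w span_singleton[OF v] by auto
  then have "c \<noteq> \<zero>\<^bsub>K\<^esub>" and wV: "w \<in> carrier V"
    using w v by auto
  then have "v = inv\<^bsub>K\<^esub> c \<odot>\<^bsub>V\<^esub> w" "inv\<^bsub>K\<^esub> c \<in> carrier K"
    using c v mult_inverse[of c v w] field.field_Units by auto
  then have "v \<in> span {w}"
    using span_singleton[OF wV] by auto
  then show ?thesis
    using w v wV by (intro equalityI span_is_subset span_is_submodule) auto
qed

text \<open>
  The dimension is a least element, which means nothing for a space without a finite generating set.
  Finiteness of the space rules this out, and then a subspace of dimension one has a one-element basis.
\<close>

lemma one_dimensional_subspace_iff:
  assumes "finite (carrier V)"
  shows "subspace K L V \<and> vectorspace.dim K (vs L) = 1 \<longleftrightarrow>
    (\<exists>v \<in> carrier V - {\<zero>\<^bsub>V\<^esub>}. L = span {v})"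
proof
  assume L: "subspace K L V \<and> vectorspace.dim K (vs L) = 1"
  then have sub: "submodule K L V" and LV: "L \<subseteq> carrier V"
    by (auto simp: subspace_def submodule_def)
  interpret W: vectorspace K "vs L"
    using L by (intro subspace_is_vs) simp
  have "W.fin_dim"
    \<comment> \<open>All of \<open>L\<close> serves as a finite generating set.\<close>
    unfolding W.fin_dim_def using finite_subset[OF LV assms] W.in_own_span[of L] W.span_is_subset2[of L]
    by (intro exI[of _ L]) auto
  then obtain B where B: "finite B" "W.basis B"
    using W.finite_basis_exists by blast
  then have "card B = 1"
    using L W.dim_basis by metis
  then obtain v where v: "B = {v}"
    by (auto simp: card_1_singleton_iff)
  have vL: "{v} \<subseteq> L" and gen: "W.span {v} = L" and li: "W.lin_indpt {v}"
    using B v by (auto simp: W.basis_def)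
  have "span {v} = L" "lin_indpt {v}"
    using span_li_not_depend[OF vL sub] gen li by auto
  moreover have "v \<noteq> \<zero>\<^bsub>V\<^esub>"
    using \<open>lin_indpt {v}\<close> zero_lin_dep[of "{v}"] R.one_closed one_not_zero by blast
  ultimately show "\<exists>v \<in> carrier V - {\<zero>\<^bsub>V\<^esub>}. L = span {v}"
    using vL LV by blast
next
  assume "\<exists>v \<in> carrier V - {\<zero>\<^bsub>V\<^esub>}. L = span {v}"
  then show "subspace K L V \<and> vectorspace.dim K (vs L) = 1"
    using dim_span_lin_indpt[of "{_}"] lin_indpt_singleton span_is_subspace[of "{_}"] by auto
qed

lemma lin_indpt_pair:
  assumes v: "v \<in> carrier V" and w: "w \<in> carrier V" "w \<noteq> \<zero>\<^bsub>V\<^esub>"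
    and vz: "v \<noteq> \<zero>\<^bsub>V\<^esub>" and ne: "span {v} \<noteq> span {w}"
  shows "lin_indpt {v, w}"
proof -
  have "w \<notin> span {v}"
    using span_singleton_eqI[OF v _ w(2)] ne by auto
  moreover have "w \<notin> {v}" using ne by auto
  ultimately have "lin_indpt ({v} \<union> {w})"
    using lin_dep_iff_in_span[of "{v}" w] lin_indpt_singleton v w vz by auto
  then show ?thesis by (simp add: insert_commute)
qed

lemma span_UN_span_singleton:
  assumes "A \<subseteq> carrier V"
  shows "span (\<Union>v\<in>A. span {v}) = span A"
proof
  have "span {v} \<subseteq> span A" if "v \<in> A" for v
    using that by (intro span_is_monotone) auto
  then show "span (\<Union>v\<in>A. span {v}) \<subseteq> span A"
    using assms by (intro span_is_subset span_is_submodule) auto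
  have "A \<subseteq> (\<Union>v\<in>A. span {v})"
    using assms span_self by auto
  then show "span A \<subseteq> span (\<Union>v\<in>A. span {v})"
    by (rule span_is_monotone)
qed

text \<open>
  Representing vectors of one line or of two distinct lines are linearly independent. The bound on
  the number of lines is essential: three lines may lie in a plane.
\<close>

lemma dim_span_Union_lines:
  assumes \<sigma>: "\<sigma> \<subseteq> (\<lambda>v. span {v}) ` (carrier V - {\<zero>\<^bsub>V\<^esub>})" "\<sigma> \<noteq> {}" "finite \<sigma>" "card \<sigma> \<le> 2"
  shows "vectorspace.dim K (vs (span (\<Union>\<sigma>))) = card \<sigma>"
proof -
  obtain A where A: "A \<subseteq> carrier V - {\<zero>\<^bsub>V\<^esub>}" "\<sigma> = (\<lambda>v. span {v}) ` A" "inj_on (\<lambda>v. span {v}) A"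
    using \<sigma>(1) by (auto simp: subset_image_inj)
  have card: "card A = card \<sigma>" and fin: "finite A"
    using A \<sigma>(3) by (auto simp: card_image finite_image_iff)
  moreover have "A \<noteq> {}" using A \<sigma>(2) by auto
  ultimately have "card A = 1 \<or> card A = 2"
    using \<sigma>(4) card_gt_0_iff[of A] by linarith
  then have "lin_indpt A"
  proof
    assume "card A = 1"
    then show ?thesis
      using A(1) lin_indpt_singleton by (auto simp: card_1_singleton_iff)
  next
    assume "card A = 2"
    then obtain v w where "A = {v, w}" "v \<noteq> w" by (auto simp: card_2_iff)
    then show ?thesis
      using A(1,3) by (intro lin_indpt_pair[of v w, folded \<open>A = {v, w}\<close>]) auto
  qed
  then have "vectorspace.dim K (vs (span A)) = card A"
    using A(1) fin by (intro dim_span_lin_indpt) auto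
  moreover have "span (\<Union>\<sigma>) = span A"
    using span_UN_span_singleton[of A] A by auto
  ultimately show ?thesis
    using card by simp
qed

lemma card_span_singleton:
  assumes "v \<in> carrier V" "v \<noteq> \<zero>\<^bsub>V\<^esub>"
  shows "card (span {v}) = card (carrier K)"
proof -
  have "inj_on (\<lambda>c. c \<odot>\<^bsub>V\<^esub> v) (carrier K)"
  proof (rule inj_onI)
    fix c d assume cd: "c \<in> carrier K" "d \<in> carrier K" "c \<odot>\<^bsub>V\<^esub> v = d \<odot>\<^bsub>V\<^esub> v"
    then have "(c \<ominus>\<^bsub>K\<^esub> d) \<odot>\<^bsub>V\<^esub> v = \<zero>\<^bsub>V\<^esub>"
      using assms by (simp add: a_minus_def smult_l_distr smult_l_minus M.r_neg)
    moreover have "e = \<zero>\<^bsub>K\<^esub>" if "e \<in> carrier K" "e \<odot>\<^bsub>V\<^esub> v = \<zero>\<^bsub>V\<^esub>" for e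
    proof (rule ccontr)
      assume e: "e \<noteq> \<zero>\<^bsub>K\<^esub>"
      then have "v = inv\<^bsub>K\<^esub> e \<odot>\<^bsub>V\<^esub> \<zero>\<^bsub>V\<^esub>"
        using mult_inverse that assms(1) by blast
      moreover have "inv\<^bsub>K\<^esub> e \<in> carrier K"
        using e that(1) field_Units by simp
      ultimately show False
        using assms(2) by simp
    qed
    ultimately have "c \<ominus>\<^bsub>K\<^esub> d = \<zero>\<^bsub>K\<^esub>"
      using cd R.minus_closed by blast
    then show "c = d"
      using cd R.r_right_minus_eq by simp
  qed
  moreover have "span {v} = (\<lambda>c. c \<odot>\<^bsub>V\<^esub> v) ` carrier K"
    using span_singleton[OF assms(1)] by auto
  ultimately show ?thesis
    by (simp add: card_image)
qed

text \<open>
  Each nonzero vector lies on exactly one line, the line that it spans, and each line has as many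
  nonzero vectors as the field has nonzero scalars; hence the nonzero vectors are counted by the
  fibres of \<open>v \<mapsto> span {v}\<close>.
\<close>

lemma card_lines:
  assumes fin: "finite (carrier V)"
  shows "card ((\<lambda>v. span {v}) ` (carrier V - {\<zero>\<^bsub>V\<^esub>})) * (card (carrier K) - 1) = card (carrier V) - 1"
proof -
  let ?S = "carrier V - {\<zero>\<^bsub>V\<^esub>}"
  have fib: "card {v \<in> ?S. span {v} = L} = card (carrier K) - 1" if L: "L \<in> (\<lambda>v. span {v}) ` ?S" for L
  proof -
    obtain v where v: "v \<in> carrier V" "v \<noteq> \<zero>\<^bsub>V\<^esub>" "L = span {v}"
      using L by auto
    have LV: "L \<subseteq> carrier V" using v span_is_subset2[of "{v}"] by auto
    have "{v \<in> ?S. span {v} = L} = L - {\<zero>\<^bsub>V\<^esub>}"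
    proof (intro equalityI subsetI)
      fix w assume "w \<in> {v \<in> ?S. span {v} = L}"
      then show "w \<in> L - {\<zero>\<^bsub>V\<^esub>}"
        using span_self by blast
    next
      fix w assume "w \<in> L - {\<zero>\<^bsub>V\<^esub>}"
      then show "w \<in> {v \<in> ?S. span {v} = L}"
        using LV span_singleton_eqI[OF v(1), of w] unfolding v(3) by blast
    qed
    moreover have "\<zero>\<^bsub>V\<^esub> \<in> L" using v span_zero by simp
    ultimately show ?thesis
      using card_span_singleton[OF v(1,2)] v(3) by (simp add: card_Diff_singleton)
  qed
  have "card (carrier V) - 1 = card ?S"
    by (simp add: card_Diff_singleton)
  also have "\<dots> = (\<Sum>L\<in>(\<lambda>v. span {v}) ` ?S. card {v \<in> ?S. span {v} = L})"
    using sum.image_gen[of ?S "\<lambda>_. 1::nat" "\<lambda>v. span {v}"] fin by simp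
  also have "\<dots> = card ((\<lambda>v. span {v}) ` ?S) * (card (carrier K) - 1)"
    using fib by simp
  finally show ?thesis by simp
qed

end

section \<open>The universal complex\<close>

lemma carrier_Fp_space:
  assumes "prime p"
  shows "carrier (Fp_space p r) = {..<r} \<rightarrow>\<^sub>E carrier (residue_ring (int p))"
proof -
  interpret residues_prime p "residue_ring (int p)"
    by unfold_locales (use assms in auto)
  show ?thesis
    by (simp add: Fp_space_def func_space_def)
qed

lemma card_carrier_residue_ring: "card (carrier (residue_ring (int p))) = p"
  by (simp add: residue_ring_def)

lemma
  assumes "prime p"
  shows finite_carrier_Fp_space: "finite (carrier (Fp_space p r))"
    and card_carrier_Fp_space: "card (carrier (Fp_space p r)) = p ^ r"
proof -
  have "finite (carrier (residue_ring (int p)))"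
    by (simp add: residue_ring_def)
  then show "finite (carrier (Fp_space p r))"
    by (simp add: carrier_Fp_space[OF assms] finite_PiE)
  show "card (carrier (Fp_space p r)) = p ^ r"
    by (simp add: carrier_Fp_space[OF assms] card_PiE card_carrier_residue_ring)
qed

text \<open>
  This description of the lines by spanning vectors is what gives access to the results for
  arbitrary finite vector spaces.
\<close>

lemma Fp_lines_eq:
  assumes "prime p"
  shows "Fp_lines p r =
    (\<lambda>v. LinearCombinations.module.span (residue_ring (int p)) (Fp_space p r) {v}) `
      (carrier (Fp_space p r) - {\<zero>\<^bsub>Fp_space p r\<^esub>})"
proof -
  interpret vectorspace "residue_ring (int p)" "Fp_space p r"
    by (rule vectorspace_Fp_space[OF assms])
  show ?thesis
    unfolding Fp_lines_def Fp_dim_def one_dimensional_subspace_iff[OF finite_carrier_Fp_space[OF assms]]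
    by blast
qed

lemma finite_Fp_lines: "prime p \<Longrightarrow> finite (Fp_lines p r)"
  by (simp add: Fp_lines_eq finite_carrier_Fp_space)

lemma card_Fp_lines:
  assumes "prime p"
  shows "(p - 1) * card (Fp_lines p r) + 1 = p ^ r"
proof -
  interpret vectorspace "residue_ring (int p)" "Fp_space p r"
    by (rule vectorspace_Fp_space[OF assms])
  have "card (Fp_lines p r) * (p - 1) = p ^ r - 1"
    using card_lines[OF finite_carrier_Fp_space[OF assms]]
    by (simp add: Fp_lines_eq[OF assms] card_carrier_Fp_space[OF assms] card_carrier_residue_ring)
  moreover have "0 < p ^ r"
    using prime_gt_0_nat[OF assms] by simp
  ultimately show ?thesis
    by (simp add: mult.commute)
qed

text \<open>
  The vertices of \<open>K(F\<^sub>p\<^sup>r)\<close> are the lines, and any two of them are joined by an edge.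
\<close>

lemma universal_complexI:
  assumes "prime p" "\<sigma> \<subseteq> Fp_lines p r" "\<sigma> \<noteq> {}" "finite \<sigma>" "card \<sigma> \<le> 2"
  shows "\<sigma> \<in> universal_complex p r"
proof -
  interpret vectorspace "residue_ring (int p)" "Fp_space p r"
    by (rule vectorspace_Fp_space[OF assms(1)])
  show ?thesis
    using dim_span_Union_lines[of \<sigma>] assms
    by (simp add: universal_complex_def Fp_dim_def Fp_lines_eq)
qed

section \<open>Colourings\<close>

text \<open>
  If \<open>L\<close> has its vertices in \<open>X\<close> and any two elements of \<open>X\<close> span an edge of \<open>L\<close>, then being
  simplicial constrains a map out of a graph no further than taking values in \<open>X\<close>; injectivity on
  the edges says that the colouring by elements of \<open>X\<close> is proper.
\<close>

lemma nondegenerate_map_graph_complex_iff: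
  assumes G: "simple_graph V E"
    and sub: "\<And>\<sigma>. \<sigma> \<in> L \<Longrightarrow> \<sigma> \<subseteq> X"
    and edges: "\<And>\<sigma>. \<sigma> \<subseteq> X \<Longrightarrow> \<sigma> \<noteq> {} \<Longrightarrow> finite \<sigma> \<Longrightarrow> card \<sigma> \<le> 2 \<Longrightarrow> \<sigma> \<in> L"
  shows "nondegenerate_map (graph_complex V E) L f \<longleftrightarrow> f ` V \<subseteq> X \<and> (\<forall>e\<in>E. inj_on f e)"
proof
  assume f: "nondegenerate_map (graph_complex V E) L f"
  have "f v \<in> X" if "v \<in> V" for v
  proof -
    have "f ` {v} \<in> L"
      using f that unfolding nondegenerate_map_def simplicial_map_def graph_complex_def by blast
    then show ?thesis
      using sub by blast
  qed
  moreover have "inj_on f e" if "e \<in> E" for e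
    using f that unfolding nondegenerate_map_def graph_complex_def by blast
  ultimately show "f ` V \<subseteq> X \<and> (\<forall>e\<in>E. inj_on f e)"
    by blast
next
  assume f: "f ` V \<subseteq> X \<and> (\<forall>e\<in>E. inj_on f e)"
  have \<sigma>: "\<sigma> \<subseteq> V \<and> \<sigma> \<noteq> {} \<and> finite \<sigma> \<and> card \<sigma> \<le> 2 \<and> inj_on f \<sigma>" if "\<sigma> \<in> graph_complex V E" for \<sigma>
  proof (cases "\<sigma> \<in> E")
    case True
    then have "\<sigma> \<subseteq> V" "card \<sigma> = 2"
      using G by (simp_all add: simple_graph_def)
    moreover from this have "\<sigma> \<noteq> {}" "finite \<sigma>"
      by (auto intro: card_ge_0_finite)
    ultimately show ?thesis
      using f True by simp
  next
    case False
    then obtain v where "v \<in> V" "\<sigma> = {v}"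
      using \<open>\<sigma> \<in> graph_complex V E\<close> by (auto simp: graph_complex_def)
    then show ?thesis
      by simp
  qed
  have "f ` \<sigma> \<in> L" if "\<sigma> \<in> graph_complex V E" for \<sigma>
    using \<sigma>[OF that] f card_image_le[of \<sigma> f] by (intro edges) auto
  then show "nondegenerate_map (graph_complex V E) L f"
    using \<sigma> by (auto simp: nondegenerate_map_def simplicial_map_def)
qed

text \<open>
  Proper colourings can be moved along injections of the colour sets, so only the number of colours
  matters, and having more of them does no harm.
\<close>

lemma colourable_iff_chromatic_number_le:
  assumes G: "simple_graph V E" and X: "finite X"
  shows "(\<exists>f. f ` V \<subseteq> X \<and> (\<forall>e\<in>E. inj_on f e)) \<longleftrightarrow>
    chromatic_number (graph_complex V E) \<le> card X"
proof -
  define C where "C n \<longleftrightarrow> (\<exists>f. f ` V \<subseteq> {..<n::nat} \<and> (\<forall>e\<in>E. inj_on f e))" for n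
  have chi: "chromatic_number (graph_complex V E) = (LEAST n. C n)"
  proof -
    have "(\<exists>f. nondegenerate_map (graph_complex V E) (full_simplex n) f) \<longleftrightarrow> C n" for n
      unfolding C_def
      by (intro ex_cong1 nondegenerate_map_graph_complex_iff[OF G]) (auto simp: full_simplex_def)
    then show ?thesis
      unfolding chromatic_number_def by presburger
  qed
  have transfer: "\<exists>f. f ` V \<subseteq> Y \<and> (\<forall>e\<in>E. inj_on f e)"
    if g: "g ` V \<subseteq> Z" "\<forall>e\<in>E. inj_on g e" and h: "inj_on h Z" "h ` Z \<subseteq> Y" for g h Y Z
  proof (intro exI[of _ "h \<circ> g"] conjI ballI)
    show "(h \<circ> g) ` V \<subseteq> Y" using g h by fastforce
    fix e assume e: "e \<in> E"
    then have "g ` e \<subseteq> Z" using G g by (fastforce simp: simple_graph_def)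
    then show "inj_on (h \<circ> g) e"
      using g h e by (intro comp_inj_on) (auto intro: inj_on_subset)
  qed
  have "finite V" and EV: "\<And>e. e \<in> E \<Longrightarrow> e \<subseteq> V"
    using G by (auto simp: simple_graph_def)
  \<comment> \<open>Giving each vertex its own colour shows that the chromatic number is attained.\<close>
  then obtain g where "inj_on g V" "g ` V \<subseteq> {..<card V}"
    using card_le_inj[of V "{..<card V}"] by auto
  then have "C (card V)"
    unfolding C_def by (meson EV inj_on_subset)
  then have least: "C (LEAST n. C n)"
    by (rule LeastI)
  show ?thesis
  proof
    assume "\<exists>f. f ` V \<subseteq> X \<and> (\<forall>e\<in>E. inj_on f e)"
    then obtain f where f: "f ` V \<subseteq> X" "\<forall>e\<in>E. inj_on f e" by blast
    obtain h where "inj_on h X" "h ` X \<subseteq> {..<card X}"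
      using card_le_inj[of X "{..<card X}"] X by auto
    then have "C (card X)"
      unfolding C_def by (rule transfer[OF f])
    then show "chromatic_number (graph_complex V E) \<le> card X"
      unfolding chi by (rule Least_le)
  next
    assume "chromatic_number (graph_complex V E) \<le> card X"
    then obtain h where h: "inj_on h {..<LEAST n. C n}" "h ` {..<LEAST n. C n} \<subseteq> X"
      using card_le_inj[of "{..<LEAST n. C n}" X] X by (auto simp: chi)
    obtain f where "f ` V \<subseteq> {..<LEAST n. C n}" "\<forall>e\<in>E. inj_on f e"
      using least unfolding C_def by blast
    then show "\<exists>f. f ` V \<subseteq> X \<and> (\<forall>e\<in>E. inj_on f e)"
      by (rule transfer) (use h in auto)
  qed
qed

section \<open>The Buchstaber invariant of a graph\<close>

text \<open>
  The assumption \<open>1 \<le> a\<close> makes the logarithm nonnegative, so that its ceiling is a natural number.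
\<close>

lemma Least_power_ge:
  assumes p: "2 \<le> p" and a: "1 \<le> a"
  shows "int (LEAST r. a \<le> p ^ r) = \<lceil>log (real p) (real a)\<rceil>"
proof -
  have iff: "a \<le> p ^ r \<longleftrightarrow> nat \<lceil>log (real p) (real a)\<rceil> \<le> r" for r
  proof -
    have "a \<le> p ^ r \<longleftrightarrow> real a \<le> real p ^ r"
      by (metis of_nat_le_iff of_nat_power)
    also have "\<dots> \<longleftrightarrow> log (real p) (real a) \<le> real r"
      using p a by (subst log_le_iff) (auto simp: powr_realpow)
    finally show ?thesis by (simp add: ceiling_le_iff)
  qed
  have "0 \<le> log (real p) (real a)"
    using p a by simp
  then have "0 \<le> \<lceil>log (real p) (real a)\<rceil>"
    by linarith
  moreover have "(LEAST r. a \<le> p ^ r) = nat \<lceil>log (real p) (real a)\<rceil>"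
    unfolding iff by (rule Least_equality) auto
  ultimately show ?thesis by simp
qed

theorem proposition5p11:
  fixes p m :: nat and V :: "'a set" and E :: "'a set set"
  assumes "prime p" and "simple_graph V E" and "card V = m"
  shows "buchstaber_mod p (graph_complex V E) =
    int m - \<lceil>log (real p) ((real p - 1) * real (chromatic_number (graph_complex V E)) + 1)\<rceil>"
proof -
  let ?\<gamma> = "chromatic_number (graph_complex V E)"
  have p: "2 \<le> p"
    using \<open>prime p\<close> by (rule prime_ge_2_nat)
  have "(\<exists>f. nondegenerate_map (graph_complex V E) (universal_complex p r) f) \<longleftrightarrow>
    (p - 1) * ?\<gamma> + 1 \<le> p ^ r" for r
  proof -
    have "(\<exists>f. nondegenerate_map (graph_complex V E) (universal_complex p r) f) \<longleftrightarrow>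
      ?\<gamma> \<le> card (Fp_lines p r)"
      unfolding colourable_iff_chromatic_number_le[OF assms(2) finite_Fp_lines[OF \<open>prime p\<close>], symmetric]
      by (intro ex_cong1 nondegenerate_map_graph_complex_iff[OF assms(2)]
          universal_complexI[OF \<open>prime p\<close>]) (auto simp: universal_complex_def)
    also have "\<dots> \<longleftrightarrow> (p - 1) * ?\<gamma> \<le> (p - 1) * card (Fp_lines p r)"
      using p by simp
    also have "\<dots> \<longleftrightarrow> (p - 1) * ?\<gamma> + 1 \<le> p ^ r"
      using card_Fp_lines[OF \<open>prime p\<close>, of r] by linarith
    finally show ?thesis .
  qed
  then have "buchstaber_mod p (graph_complex V E) =
      int m - int (LEAST r. (p - 1) * ?\<gamma> + 1 \<le> p ^ r)"
    using assms(3) simplicial_complex_graph_complex(2)[OF assms(2)]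
    by (simp add: buchstaber_mod_def)
  also have "int (LEAST r. (p - 1) * ?\<gamma> + 1 \<le> p ^ r) = \<lceil>log (real p) (real ((p - 1) * ?\<gamma> + 1))\<rceil>"
    using p by (intro Least_power_ge) auto
  also have "real ((p - 1) * ?\<gamma> + 1) = (real p - 1) * real ?\<gamma> + 1"
    using p by (simp add: of_nat_diff)
  finally show ?thesis .
qed

end
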